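(* Let $k$ be a positive integer. For every $0\leq\gamma<\frac14$ and every $\epsilon>0$ there exist an instance of Graph Balancing and a target makespan $T$ such that (1) the relaxation $LP_k$ for target $T$ is feasible, with optimal value $OPT_{LP_k}$, and (2) every orientation whose makespan is at most $(1.75+\gamma)T$ has orientation cost at least $\frac{1}{\gamma+0.75+\epsilon}\,OPT_{LP_k}$.
   Context: Graph Balancing: an undirected multigraph $G=(V,E)$ (self-loops allowed), edge weights $p:E\to\mathbb{R}^{+}$, nonnegative orientation costs $c_{e,u}$ for $e\in E$, $u\in e$. An orientation assigns each edge $e$ to an endpoint $\eta(e)\in e$; the load of $u$ is $\sum_{e:\eta(e)=u}p_e$, the makespan is the maximum load, and the orientation cost is $\sum_e c_{e,\eta(e)}$. For $u\in V$ let $\delta(u)$ be the set of edges incident to $u$. The relaxation $LP_k$ for target $T$ has variables $x_{e,u}\ge 0$ for $e\in E$, $u\in e$, and is: minimize $\sum_{e\in E}\sum_{u\in e}c_{e,u}x_{e,u}$ subject to (Edge) $\sum_{u\in e}x_{e,u}=1$ for all $e\in E$; (Load) $\sum_{e\in\delta(u)}x_{e,u}p_e\le T$ for all $u\in V$; (Star) $\sum_{e\in\delta(u):\,p_e>T/2}x_{e,u}\le 1$ for all $u\in V$; (Set) $\sum_{e\in S}x_{e,u}\le |S|-1$ for all $u\in V$ and all $S\subseteq\delta(u)$ with $\sum_{e\in S}p_e>T$ and $|S|\le k$; and $x_{e,u}=0$ whenever $p_e>T$. $OPT_{LP_k}$ denotes its optimal value. *)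

theory Defs
  imports Complex_Main
begin

record ('v, 'e) gb_instance =
  verts :: "'v set"
  edges :: "'e set"
  ends :: "'e \<Rightarrow> 'v set"
  weight :: "'e \<Rightarrow> real"
  cost :: "'e \<Rightarrow> 'v \<Rightarrow> real"

text \<open>Edges are abstract names, so parallel edges are permitted; a self-loop at \<open>u\<close> is an edge
  whose set of ends is \<open>{u}\<close>. Nonemptiness of the vertex set makes the makespan (a maximum over
  the vertices) well defined.\<close>

definition graph_balancing :: "('v, 'e) gb_instance \<Rightarrow> bool" where
  "graph_balancing G \<longleftrightarrow>
     finite (verts G) \<and> verts G \<noteq> {} \<and> finite (edges G) \<and>
     (\<forall>e\<in>edges G. ends G e \<subseteq> verts G \<and> (card (ends G e) = 1 \<or> card (ends G e) = 2)) \<and>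
     (\<forall>e\<in>edges G. weight G e > 0) \<and>
     (\<forall>e\<in>edges G. \<forall>u\<in>ends G e. cost G e u \<ge> 0)"

definition incident :: "('v, 'e) gb_instance \<Rightarrow> 'v \<Rightarrow> 'e set" where
  "incident G u = {e \<in> edges G. u \<in> ends G e}"

definition orientation :: "('v, 'e) gb_instance \<Rightarrow> ('e \<Rightarrow> 'v) \<Rightarrow> bool" where
  "orientation G \<eta> \<longleftrightarrow> (\<forall>e\<in>edges G. \<eta> e \<in> ends G e)"

definition load :: "('v, 'e) gb_instance \<Rightarrow> ('e \<Rightarrow> 'v) \<Rightarrow> 'v \<Rightarrow> real" where
  "load G \<eta> u = (\<Sum>e\<in>{e \<in> edges G. \<eta> e = u}. weight G e)"

definition makespan :: "('v, 'e) gb_instance \<Rightarrow> ('e \<Rightarrow> 'v) \<Rightarrow> real" where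
  "makespan G \<eta> = Max (load G \<eta> ` verts G)"

definition orientation_cost :: "('v, 'e) gb_instance \<Rightarrow> ('e \<Rightarrow> 'v) \<Rightarrow> real" where
  "orientation_cost G \<eta> = (\<Sum>e\<in>edges G. cost G e (\<eta> e))"

text \<open>The variables of the relaxation are the values \<open>x e u\<close> with \<open>e \<in> edges G\<close> and \<open>u \<in> ends G e\<close>;
  all other values of \<open>x\<close> are unconstrained and do not enter the objective.\<close>

definition LP_feasible ::
    "nat \<Rightarrow> ('v, 'e) gb_instance \<Rightarrow> real \<Rightarrow> ('e \<Rightarrow> 'v \<Rightarrow> real) \<Rightarrow> bool" where
  "LP_feasible k G T x \<longleftrightarrow>
     (\<forall>e\<in>edges G. \<forall>u\<in>ends G e. x e u \<ge> 0) \<and>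
     (\<forall>e\<in>edges G. (\<Sum>u\<in>ends G e. x e u) = 1) \<and>
     (\<forall>u\<in>verts G. (\<Sum>e\<in>incident G u. x e u * weight G e) \<le> T) \<and>
     (\<forall>u\<in>verts G. (\<Sum>e\<in>{e \<in> incident G u. weight G e > T / 2}. x e u) \<le> 1) \<and>
     (\<forall>u\<in>verts G. \<forall>S. S \<subseteq> incident G u \<and> (\<Sum>e\<in>S. weight G e) > T \<and> card S \<le> k
        \<longrightarrow> (\<Sum>e\<in>S. x e u) \<le> real (card S) - 1) \<and>
     (\<forall>e\<in>edges G. \<forall>u\<in>ends G e. weight G e > T \<longrightarrow> x e u = 0)"

definition LP_cost :: "('v, 'e) gb_instance \<Rightarrow> ('e \<Rightarrow> 'v \<Rightarrow> real) \<Rightarrow> real" where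
  "LP_cost G x = (\<Sum>e\<in>edges G. \<Sum>u\<in>ends G e. cost G e u * x e u)"

definition OPT_LP :: "nat \<Rightarrow> ('v, 'e) gb_instance \<Rightarrow> real \<Rightarrow> real" where
  "OPT_LP k G T = Inf {LP_cost G x | x. LP_feasible k G T x}"

end

theory Submission
  imports Defs
begin

text \<open>Take \<open>T = 1\<close> and two vertices \<open>0\<close>, \<open>1\<close>, joined by a single edge of weight \<open>1 - \<delta>\<close> that costs
  \<open>1\<close> when oriented towards \<open>0\<close>. Vertex \<open>1\<close> carries \<open>N\<close> free self-loops of total weight
  \<open>D = 3/4 + \<gamma> + 2\<delta>\<close>. Orienting the big edge towards \<open>1\<close> gives load \<open>7/4 + \<gamma> + \<delta>\<close>, so a good
  orientation must pay \<open>1\<close>, whereas the relaxation may send the fraction \<open>1 - D\<close> of it to \<open>1\<close> and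
  pays only \<open>D\<close>. If the loops are so light that \<open>k\<close> of them weigh at most \<open>\<delta>\<close>, no set of at most
  \<open>k\<close> edges exceeds \<open>T\<close>, and the set constraints are void.\<close>

definition gap_instance :: "real \<Rightarrow> real \<Rightarrow> nat \<Rightarrow> (nat, nat) gb_instance" where
  "gap_instance \<delta> D N =
     \<lparr>verts = {0, 1}, edges = {..N},
      ends = (\<lambda>e. if e = 0 then {0, 1} else {1}),
      weight = (\<lambda>e. if e = 0 then 1 - \<delta> else D / real N),
      cost = (\<lambda>e u. if e = 0 \<and> u = 0 then 1 else 0)\<rparr>"

definition gap_solution :: "real \<Rightarrow> nat \<Rightarrow> nat \<Rightarrow> real" where
  "gap_solution D e u = (if e = 0 then (if u = 0 then D else 1 - D) else 1)"

lemma gap_instance_simps [simp]: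
  "verts (gap_instance \<delta> D N) = {0, 1}"
  "edges (gap_instance \<delta> D N) = {..N}"
  "ends (gap_instance \<delta> D N) e = (if e = 0 then {0, 1} else {1})"
  "weight (gap_instance \<delta> D N) e = (if e = 0 then 1 - \<delta> else D / real N)"
  "cost (gap_instance \<delta> D N) e u = (if e = 0 \<and> u = 0 then 1 else 0)"
  by (simp_all add: gap_instance_def)

lemma incident_gap_instance [simp]:
  "incident (gap_instance \<delta> D N) 0 = {0}"
  "incident (gap_instance \<delta> D N) (Suc 0) = {..N}"
  by (auto simp: incident_def split: if_splits)

lemma sum_atMost_split_0:
  fixes f :: "nat \<Rightarrow> 'a::comm_monoid_add"
  shows "sum f {..N} = f 0 + sum f {1..N}"
  by (simp add: atMost_atLeast0 sum.atLeast_Suc_atMost)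

lemma graph_balancing_gap_instance:
  assumes "\<delta> < 1" "0 < D" "0 < N"
  shows "graph_balancing (gap_instance \<delta> D N)"
  using assms by (auto simp: graph_balancing_def)

lemma LP_cost_gap_instance: "LP_cost (gap_instance \<delta> D N) x = x 0 0"
  by (simp add: LP_cost_def sum_atMost_split_0)

lemma orientation_cost_gap_instance:
  "orientation_cost (gap_instance \<delta> D N) \<eta> = (if \<eta> 0 = 0 then 1 else 0)"
  by (simp add: orientation_cost_def sum_atMost_split_0)

text \<open>The premise of a set constraint with \<open>T = 1\<close> thus never holds. If
  \<open>S\<close> contains the big edge, its at most \<open>k\<close> loops add at most \<delta> to
  \<open>1 - \<delta>\<close>; otherwise \<open>S\<close> has only loops, which weigh
  \<open>D \<le> 1\<close> in total.\<close>

lemma small_set_weight_gap_instance: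
  assumes "0 \<le> \<delta>" "0 \<le> D" "D \<le> 1" "0 < N" "real k * D \<le> \<delta> * real N"
    and "S \<subseteq> {..N}" "card S \<le> k"
  shows "(\<Sum>e\<in>S. weight (gap_instance \<delta> D N) e) \<le> 1"
proof -
  have fin: "finite S" using assms(6) finite_subset by blast
  have loops: "(\<Sum>e\<in>S - {0}. weight (gap_instance \<delta> D N) e) = real (card (S - {0})) * (D / real N)"
    by simp
  show ?thesis
  proof (cases "0 \<in> S")
    case True
    have "real (card (S - {0})) * (D / real N) \<le> real k * (D / real N)"
      using assms card_Diff1_le[of S 0] by (intro mult_right_mono) auto
    also have "\<dots> \<le> \<delta>"
      using assms by (simp add: field_simps)
    finally show ?thesis
      using loops True fin by (simp add: sum.remove)
  next
    case False
    have "card (S - {0}) \<le> card {1..N}"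
      using assms(6) by (intro card_mono) auto
    then have "real (card (S - {0})) * (D / real N) \<le> real N * (D / real N)"
      using assms by (intro mult_right_mono) auto
    also have "\<dots> \<le> 1"
      using assms by simp
    finally have "(\<Sum>e\<in>S - {0}. weight (gap_instance \<delta> D N) e) \<le> 1"
      using loops by linarith
    then show ?thesis
      using False by (metis Diff_empty Diff_insert0)
  qed
qed

lemma LP_feasible_gap_solution:
  assumes "0 \<le> \<delta>" "\<delta> < 1/2" "0 \<le> D" "D \<le> 1" "0 < N" "D < real N / 2"
    and "real k * D \<le> \<delta> * real N"
  shows "LP_feasible k (gap_instance \<delta> D N) 1 (gap_solution D)"
proof -
  let ?G = "gap_instance \<delta> D N" and ?x = "gap_solution D"
  \<comment> \<open>These bound the loads at the two vertices: \<open>D * (1 - \<delta>)\<close> at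
    \<open>0\<close>, and \<open>(1 - D) * (1 - \<delta>) + D \<le> (1 - D) + D\<close> at
    \<open>1\<close>.\<close>
  have "D * (1 - \<delta>) \<le> 1 * 1" and "(1 - D) * (1 - \<delta>) \<le> (1 - D) * 1"
    using assms by (intro mult_mono; simp)+
  then have load: "(\<Sum>e\<in>incident ?G u. ?x e u * weight ?G e) \<le> 1" if "u \<in> verts ?G" for u
    using that assms by (auto simp: gap_solution_def sum_atMost_split_0)
  \<comment> \<open>The big edge exceeds \<open>1 / 2\<close> by \<open>\<delta> < 1/2\<close>, the
    loops do not by \<open>D < real N / 2\<close>; so the star constraint only asks that
    \<open>D\<close> and \<open>1 - D\<close> be at most \<open>1\<close>.\<close>
  have big: "{e \<in> incident ?G u. weight ?G e > 1 / 2} = {0}" if "u \<in> verts ?G" for u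
    using that assms by (auto simp: field_simps)
  have set: "(\<Sum>e\<in>S. weight ?G e) \<le> 1" if "u \<in> verts ?G" "S \<subseteq> incident ?G u" "card S \<le> k" for u S
    using that assms by (intro small_set_weight_gap_instance) auto
  show ?thesis
    unfolding LP_feasible_def
  proof (intro conjI)
    show "\<forall>u\<in>verts ?G. (\<Sum>e\<in>{e \<in> incident ?G u. weight ?G e > 1 / 2}. ?x e u) \<le> 1"
    proof
      fix u assume "u \<in> verts ?G"
      then show "(\<Sum>e\<in>{e \<in> incident ?G u. weight ?G e > 1 / 2}. ?x e u) \<le> 1"
        using assms unfolding big[OF \<open>u \<in> verts ?G\<close>] by (simp add: gap_solution_def)
    qed
    show "\<forall>u\<in>verts ?G. \<forall>S. S \<subseteq> incident ?G u \<and> (\<Sum>e\<in>S. weight ?G e) > 1 \<and> card S \<le> k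
        \<longrightarrow> (\<Sum>e\<in>S. ?x e u) \<le> real (card S) - 1"
      using set by (meson linorder_not_less)
    show "\<forall>e\<in>edges ?G. \<forall>u\<in>ends ?G e. weight ?G e > 1 \<longrightarrow> ?x e u = 0"
      using assms by (auto simp: field_simps)
  qed (use assms load in \<open>auto simp: gap_solution_def\<close>)
qed

text \<open>Loops have a single end, so they put load \<open>D\<close> on vertex \<open>1\<close>,
  which limits the share of the big edge that it can take. The bound on the cost serves to show that
  the optimum is positive and that the infimum is over a set bounded below.\<close>

lemma LP_feasible_gap_instance_lower:
  assumes "LP_feasible k (gap_instance \<delta> D N) 1 x" "\<delta> < 1" "0 < N"
  shows "(D - \<delta>) / (1 - \<delta>) \<le> x 0 0"
proof -
  let ?G = "gap_instance \<delta> D N"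
  have edge: "(\<Sum>u\<in>ends ?G e. x e u) = 1" if "e \<in> edges ?G" for e
    using assms(1) that unfolding LP_feasible_def by blast
  have "(\<Sum>e\<in>incident ?G (Suc 0). x e (Suc 0) * weight ?G e) \<le> 1"
    using assms(1) by (simp add: LP_feasible_def)
  moreover have "x 0 (Suc 0) = 1 - x 0 0"
    using edge[of 0] by simp
  moreover have "x e (Suc 0) = 1" if "e \<in> {1..N}" for e
    using edge[of e] that by simp
  ultimately have "(1 - x 0 0) * (1 - \<delta>) + D \<le> 1"
    using assms(3) by (simp add: sum_atMost_split_0)
  then show ?thesis
    using assms(2) by (simp add: field_simps)
qed

lemma load_gap_instance:
  assumes "orientation (gap_instance \<delta> D N) \<eta>" "\<eta> 0 \<noteq> 0" "0 < N"
  shows "load (gap_instance \<delta> D N) \<eta> 1 = 1 - \<delta> + D"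
proof -
  have "\<eta> e = 1" if "e \<le> N" for e
    using assms that by (auto simp: orientation_def split: if_splits)
  then have "{e \<in> edges (gap_instance \<delta> D N). \<eta> e = 1} = {..N}"
    by auto
  then show ?thesis
    using assms(3) unfolding load_def by (simp add: sum_atMost_split_0)
qed

theorem theorem3:
  fixes k :: nat and \<gamma> \<epsilon> :: real
  assumes "k > 0" and "0 \<le> \<gamma>" and "\<gamma> < 1 / 4" and "\<epsilon> > 0"
  shows "\<exists>(G :: (nat, nat) gb_instance) (T :: real).
           graph_balancing G \<and>
           (\<exists>x. LP_feasible k G T x) \<and> OPT_LP k G T > 0 \<and>
           (\<forall>\<eta>. orientation G \<eta> \<and> makespan G \<eta> \<le> (7 / 4 + \<gamma>) * T \<longrightarrow>
                orientation_cost G \<eta> \<ge> 1 / (\<gamma> + 3 / 4 + \<epsilon>) * OPT_LP k G T)"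
proof -
  \<comment> \<open>The bound by \<open>\<epsilon> / 2\<close> gives
    \<open>D \<le> \<gamma> + 3 / 4 + \<epsilon>\<close>, the other one
    \<open>D \<le> 1\<close>.\<close>
  define \<delta> where "\<delta> = min \<epsilon> (1 / 4 - \<gamma>) / 2"
  \<comment> \<open>One \<delta> makes up for the big edge weighing only
    \<open>1 - \<delta>\<close>; the other pushes the load strictly above
    \<open>7 / 4 + \<gamma>\<close>.\<close>
  define D where "D = 3 / 4 + \<gamma> + 2 * \<delta>"
  have \<delta>: "0 < \<delta>" "\<delta> < 1 / 2" "2 * \<delta> \<le> \<epsilon>" and D: "3 / 4 \<le> D" "D \<le> 1" "\<delta> < D" "D \<le> \<gamma> + 3 / 4 + \<epsilon>"
    using assms by (auto simp: \<delta>_def D_def min_def)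
  \<comment> \<open>The \<open>3\<close> ensures \<open>D < real N / 2\<close>, as
    \<open>D \<le> 1\<close>; the quotient makes \<open>k\<close> loops weigh at most
    \<delta>.\<close>
  obtain N :: nat where "max 3 (real k * D / \<delta>) \<le> real N"
    using real_arch_simple by blast
  then have N: "3 \<le> real N" "real k * D \<le> \<delta> * real N"
    using \<delta> by (auto simp: field_simps)
  let ?G = "gap_instance \<delta> D N"
  let ?C = "{LP_cost ?G x | x. LP_feasible k ?G 1 x}"
  have feas: "LP_feasible k ?G 1 (gap_solution D)"
    using \<delta> D N by (intro LP_feasible_gap_solution) auto
  have low: "(D - \<delta>) / (1 - \<delta>) \<le> c" if "c \<in> ?C" for c
    using that LP_feasible_gap_instance_lower[of k \<delta> D N] \<delta> N by (auto simp: LP_cost_gap_instance)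
  have "(D - \<delta>) / (1 - \<delta>) \<le> OPT_LP k ?G 1"
    unfolding OPT_LP_def using feas low by (intro cInf_greatest) auto
  moreover have "0 < (D - \<delta>) / (1 - \<delta>)"
    using \<delta> D by simp
  ultimately have pos: "0 < OPT_LP k ?G 1"
    by linarith
  have "OPT_LP k ?G 1 \<le> LP_cost ?G (gap_solution D)"
    unfolding OPT_LP_def using feas low by (intro cInf_lower bdd_belowI) auto
  then have opt: "OPT_LP k ?G 1 \<le> D"
    by (simp add: LP_cost_gap_instance gap_solution_def)
  have "1 / (\<gamma> + 3 / 4 + \<epsilon>) * OPT_LP k ?G 1 \<le> orientation_cost ?G \<eta>"
    if "orientation ?G \<eta>" "makespan ?G \<eta> \<le> (7 / 4 + \<gamma>) * 1" for \<eta>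
  proof -
    have "load ?G \<eta> 1 \<le> makespan ?G \<eta>"
      by (simp add: makespan_def)
    then have "\<eta> 0 = 0"
      using load_gap_instance[OF that(1)] that(2) \<delta> N by (cases "\<eta> 0 = 0") (auto simp: D_def)
    \<comment> \<open>The orientation costs \<open>1\<close>, while the optimum is at most
      \<open>D \<le> \<gamma> + 3 / 4 + \<epsilon>\<close>.\<close>
    then show ?thesis
      using opt D assms by (simp add: orientation_cost_gap_instance)
  qed
  moreover have "graph_balancing ?G"
    using \<delta> D N by (intro graph_balancing_gap_instance) auto
  ultimately show ?thesis
    using feas pos by blast
qed

end
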